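(* Any nonconstant real harmonic function $a(u)$ of $u=(u^1,u^2)$ defines a pair of almost compatible metrics $g_1^{ij}(u)=\exp(a(u))\,\delta^{ij}$, $1\le i,j\le2$, and $g_2^{ij}(u)=\delta^{ij}$, $1\le i,j\le2$, which are not compatible. For a nonconstant (complex-valued) harmonic function $a(u)$, these metrics are compatible if and only if $a=a(u^1\pm i u^2)$, i.e. $a$ is a function of $u^1+iu^2$ alone or of $u^1-iu^2$ alone (where here $i=\sqrt{-1}$).
   Context: Harmonic means $\frac{\partial^2a}{\partial(u^1)^2}+\frac{\partial^2a}{\partial(u^2)^2}=0$ (on a connected domain). For a contravariant metric $g^{ij}$ with inverse $g_{ij}$, let $\Gamma^i_{jk}$ be the Christoffel symbols of its Levi-Civita connection and $$\Gamma^{ij}_k=g^{is}\Gamma^j_{sk},\qquad R^i_{jkl}=\frac{\partial\Gamma^i_{jl}}{\partial u^k}-\frac{\partial\Gamma^i_{jk}}{\partial u^l}+\Gamma^i_{pk}\Gamma^p_{jl}-\Gamma^i_{pl}\Gamma^p_{jk},\qquad R^{ij}_{kl}=g^{is}R^j_{skl}$$ (the same formulas are used for complex-valued metrics). Two metrics $g_1,g_2$ are almost compatible if for every linear combination $g^{ij}=\lambda_1g_1^{ij}+\lambda_2g_2^{ij}$ ($\lambda_1,\lambda_2$ constants with $\det(g^{ij})\not\equiv0$) one has $\Gamma^{ij}_k=\lambda_1\Gamma^{ij}_{1,k}+\lambda_2\Gamma^{ij}_{2,k}$; they are compatible if in addition $R^{ij}_{kl}=\lambda_1R^{ij}_{1,kl}+\lambda_2R^{ij}_{2,kl}$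 for every such linear combination. *)

theory Defs
  imports "HOL-Analysis.Analysis"
begin

definition pd :: "'n \<Rightarrow> (real ^ 'n \<Rightarrow> 'b::real_normed_vector) \<Rightarrow> real ^ 'n \<Rightarrow> 'b" where
  "pd k f u = vector_derivative (\<lambda>t. f (u + t *\<^sub>R axis k 1)) (at 0)"

(* f is of class C^m on D, where D is meant to be open. *)
primrec Ck_on :: "nat \<Rightarrow> (real ^ 'n::finite) set \<Rightarrow> (real ^ 'n \<Rightarrow> 'b::real_normed_vector) \<Rightarrow> bool" where
  "Ck_on 0 D f \<longleftrightarrow> continuous_on D f"
| "Ck_on (Suc m) D f \<longleftrightarrow> (\<forall>u\<in>D. f differentiable (at u)) \<and> (\<forall>k. Ck_on m D (pd k f))"

definition harmonic_on :: "(real ^ 'n::finite) set \<Rightarrow> (real ^ 'n \<Rightarrow> 'b::real_normed_vector) \<Rightarrow> bool" where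
  "harmonic_on D a \<longleftrightarrow> Ck_on 2 D a \<and> (\<forall>u\<in>D. (\<Sum>k\<in>UNIV. pd k (pd k a) u) = 0)"

(* A contravariant metric g^{ij} is the matrix-valued function g with g u $ i $ j = g^{ij}(u).
   The scalars 'k are the reals (pseudo-Riemannian metrics, no signature is prescribed) or the
   complex numbers; the coordinates u are real in both cases. C^2 is what curvature requires. *)
type_synonym ('k, 'n) mfield = "real ^ 'n \<Rightarrow> 'k ^ 'n ^ 'n"

definition contravariant_metric_on ::
  "(real ^ 'n::finite) set \<Rightarrow> ('k::real_normed_field, 'n) mfield \<Rightarrow> bool" where
  "contravariant_metric_on D g \<longleftrightarrow>
     (\<forall>i j. Ck_on 2 D (\<lambda>u. g u $ i $ j)) \<and>
     (\<forall>u\<in>D. transpose (g u) = g u \<and> det (g u) \<noteq> 0)"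

definition cov :: "('k::real_normed_field, 'n::finite) mfield \<Rightarrow> 'n \<Rightarrow> 'n \<Rightarrow> real ^ 'n \<Rightarrow> 'k" where
  "cov g i j u = matrix_inv (g u) $ i $ j"

(* christoffel g i j k is Gamma^i_{jk}. *)
definition christoffel ::
  "('k::real_normed_field, 'n::finite) mfield \<Rightarrow> 'n \<Rightarrow> 'n \<Rightarrow> 'n \<Rightarrow> real ^ 'n \<Rightarrow> 'k" where
  "christoffel g i j k u =
     (1 / 2) * (\<Sum>s\<in>UNIV. g u $ i $ s *
        (pd j (cov g s k) u + pd k (cov g j s) u - pd s (cov g j k) u))"

(* christoffel_up g i j k is Gamma^{ij}_k. *)
definition christoffel_up ::
  "('k::real_normed_field, 'n::finite) mfield \<Rightarrow> 'n \<Rightarrow> 'n \<Rightarrow> 'n \<Rightarrow> real ^ 'n \<Rightarrow> 'k" where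
  "christoffel_up g i j k u = (\<Sum>s\<in>UNIV. g u $ i $ s * christoffel g j s k u)"

(* riemann g i j k l is R^i_{jkl}. *)
definition riemann ::
  "('k::real_normed_field, 'n::finite) mfield \<Rightarrow> 'n \<Rightarrow> 'n \<Rightarrow> 'n \<Rightarrow> 'n \<Rightarrow> real ^ 'n \<Rightarrow> 'k" where
  "riemann g i j k l u =
     pd k (christoffel g i j l) u - pd l (christoffel g i j k) u
     + (\<Sum>p\<in>UNIV. christoffel g i p k u * christoffel g p j l u)
     - (\<Sum>p\<in>UNIV. christoffel g i p l u * christoffel g p j k u)"

(* riemann_up g i j k l is R^{ij}_{kl}. *)
definition riemann_up ::
  "('k::real_normed_field, 'n::finite) mfield \<Rightarrow> 'n \<Rightarrow> 'n \<Rightarrow> 'n \<Rightarrow> 'n \<Rightarrow> real ^ 'n \<Rightarrow> 'k" where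
  "riemann_up g i j k l u = (\<Sum>s\<in>UNIV. g u $ i $ s * riemann g j s k l u)"

definition lincomb ::
  "'k \<Rightarrow> 'k \<Rightarrow> ('k::real_normed_field, 'n::finite) mfield \<Rightarrow> ('k, 'n) mfield \<Rightarrow> ('k, 'n) mfield" where
  "lincomb c1 c2 g1 g2 u = (\<chi> i j. c1 * g1 u $ i $ j + c2 * g2 u $ i $ j)"

(* A linear combination with det not identically 0 may still degenerate at some points of D.
   There its Christoffel symbols and curvature are undefined, so the identities are required
   at the (open set of) points of D where det is nonzero. *)
definition almost_compatible_on ::
  "(real ^ 'n::finite) set \<Rightarrow> ('k::real_normed_field, 'n) mfield \<Rightarrow> ('k, 'n) mfield \<Rightarrow> bool" where
  "almost_compatible_on D g1 g2 \<longleftrightarrow>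
     contravariant_metric_on D g1 \<and> contravariant_metric_on D g2 \<and>
     (\<forall>c1 c2. (\<exists>u\<in>D. det (lincomb c1 c2 g1 g2 u) \<noteq> 0) \<longrightarrow>
        (\<forall>u\<in>D. det (lincomb c1 c2 g1 g2 u) \<noteq> 0 \<longrightarrow>
           (\<forall>i j k. christoffel_up (lincomb c1 c2 g1 g2) i j k u =
              c1 * christoffel_up g1 i j k u + c2 * christoffel_up g2 i j k u)))"

definition compatible_on ::
  "(real ^ 'n::finite) set \<Rightarrow> ('k::real_normed_field, 'n) mfield \<Rightarrow> ('k, 'n) mfield \<Rightarrow> bool" where
  "compatible_on D g1 g2 \<longleftrightarrow>
     almost_compatible_on D g1 g2 \<and>
     (\<forall>c1 c2. (\<exists>u\<in>D. det (lincomb c1 c2 g1 g2 u) \<noteq> 0) \<longrightarrow>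
        (\<forall>u\<in>D. det (lincomb c1 c2 g1 g2 u) \<noteq> 0 \<longrightarrow>
           (\<forall>i j k l. riemann_up (lincomb c1 c2 g1 g2) i j k l u =
              c1 * riemann_up g1 i j k l u + c2 * riemann_up g2 i j k l u)))"

(* "a = a(w)" for a complex coordinate w on D (here w = u^1 + i u^2 or u^1 - i u^2): a is a
   holomorphic function of w. Without holomorphy the condition would be void, as w is injective. *)
definition holomorphic_function_of ::
  "(real ^ 2 \<Rightarrow> complex) \<Rightarrow> (real ^ 2) set \<Rightarrow> (real ^ 2 \<Rightarrow> complex) \<Rightarrow> bool" where
  "holomorphic_function_of w D a \<longleftrightarrow> (\<exists>f. f holomorphic_on (w ` D) \<and> (\<forall>u\<in>D. a u = f (w u)))"

end

(* For a metric phi delta^{ij} the symbols Gamma^{ij}_k are linear in phi, and R^{ij}_{kl} is linear in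
   the second derivatives of phi up to a term proportional to |grad phi|^2 / phi, where |grad phi|^2 is
   the bilinear square phi_1^2 + phi_2^2. For phi = c1 exp a + c2 this gives almost compatibility, and
   compatibility amounts to a_1^2 + a_2^2 = 0. Over the reals this makes a constant. Over the complex
   numbers a_1^2 + a_2^2 = (a_1 - i a_2) (a_1 + i a_2), and for harmonic a the first factor is holomorphic
   in u^1 + i u^2 and the second in u^1 - i u^2. On a connected domain one factor therefore vanishes
   identically, which is the Cauchy-Riemann equation of a in u^1 - i u^2 or in u^1 + i u^2. *)
theory Submission
  imports Defs "HOL-Complex_Analysis.Conformal_Mappings"
begin

section \<open>Partial derivatives and their calculus rules\<close>

text \<open>Stated at every \<open>t\<close> and within any \<open>T\<close>, whereas
  \<open>pd\<close> looks only at \<open>t = 0\<close>: the mean value argument in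
  \<open>second_difference_pd\<close> needs the derivative along a whole segment.\<close>

lemma has_vector_derivative_pd:
  fixes f :: "real ^ 'n::finite \<Rightarrow> 'b::real_normed_vector"
  assumes "(f has_derivative f') (at (u + t *\<^sub>R axis k 1))"
  shows "((\<lambda>t. f (u + t *\<^sub>R axis k 1)) has_vector_derivative f' (axis k 1)) (at t within T)"
proof -
  have "((\<lambda>t. u + t *\<^sub>R axis k 1) has_derivative (\<lambda>h. h *\<^sub>R axis k 1)) (at t within T)"
    by (auto intro!: derivative_eq_intros)
  from has_derivative_compose[OF this assms]
  show ?thesis
    using linear_scale[OF has_derivative_linear[OF assms]] by (simp add: has_vector_derivative_def)
qed

lemma pd_eqI:
  fixes f :: "real ^ 'n::finite \<Rightarrow> 'b::real_normed_vector"
  assumes "(f has_derivative f') (at u)"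
  shows "pd k f u = f' (axis k 1)"
  unfolding pd_def
  by (rule vector_derivative_at, rule has_vector_derivative_pd) (use assms in simp)

lemma has_derivative_pd:
  fixes f :: "real ^ 'n::finite \<Rightarrow> 'b::real_normed_vector"
  assumes "f differentiable (at u)"
  shows "(f has_derivative (\<lambda>h. \<Sum>k\<in>UNIV. h $ k *\<^sub>R pd k f u)) (at u)"
proof -
  obtain f' where f': "(f has_derivative f') (at u)"
    using assms by (auto simp: differentiable_def)
  have "f' h = (\<Sum>k\<in>UNIV. h $ k *\<^sub>R pd k f u)" for h
  proof -
    have "f' h = f' (\<Sum>k\<in>UNIV. h $ k *\<^sub>R axis k 1)"
      using basis_expansion[of h] by (simp add: scalar_mult_eq_scaleR)
    also have "\<dots> = (\<Sum>k\<in>UNIV. h $ k *\<^sub>R pd k f u)"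
      using has_derivative_linear[OF f'] by (simp add: linear_sum linear_scale pd_eqI[OF f'])
    finally show ?thesis .
  qed
  then show ?thesis using f' by presburger
qed

text \<open>\<open>pd\<close> sees \<open>f\<close> only on a short piece of a coordinate line
  through \<open>u\<close>, which stays in \<open>S\<close>. This allows formulas known only on an
  open set to be differentiated.\<close>

lemma pd_cong:
  fixes f :: "real ^ 'n::finite \<Rightarrow> 'b::real_normed_vector"
  assumes "open S" "u \<in> S" "\<And>v. v \<in> S \<Longrightarrow> f v = g v"
  shows "pd k f u = pd k g u"
proof -
  let ?l = "\<lambda>t::real. u + t *\<^sub>R (axis k 1 :: real ^ 'n)"
  have "\<forall>\<^sub>F t in nhds 0. ?l t \<in> S"
    by (rule eventually_nhds_in_open[of "?l -` S", simplified])
       (use assms in \<open>auto intro!: open_vimage continuous_intros\<close>)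
  then have "\<forall>\<^sub>F t in nhds 0. t \<in> UNIV \<longrightarrow> f (?l t) = g (?l t)"
    by eventually_elim (use assms in auto)
  then show ?thesis unfolding pd_def by (rule vector_derivative_cong_eq) auto
qed

lemma pd_mult:
  fixes f g :: "real ^ 'n::finite \<Rightarrow> 'b::real_normed_algebra"
  assumes "f differentiable (at u)" "g differentiable (at u)"
  shows "pd k (\<lambda>v. f v * g v) u = f u * pd k g u + pd k f u * g u"
proof -
  obtain f' g' where "(f has_derivative f') (at u)" "(g has_derivative g') (at u)"
    using assms by (auto simp: differentiable_def)
  then show ?thesis by (simp add: pd_eqI has_derivative_mult pd_eqI[OF has_derivative_mult])
qed

lemma pd_add:
  fixes f g :: "real ^ 'n::finite \<Rightarrow> 'b::real_normed_vector"
  assumes "f differentiable (at u)" "g differentiable (at u)"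
  shows "pd k (\<lambda>v. f v + g v) u = pd k f u + pd k g u"
proof -
  obtain f' g' where "(f has_derivative f') (at u)" "(g has_derivative g') (at u)"
    using assms by (auto simp: differentiable_def)
  then show ?thesis by (simp add: pd_eqI[OF has_derivative_add] pd_eqI)
qed

lemma pd_diff:
  fixes f g :: "real ^ 'n::finite \<Rightarrow> 'b::real_normed_vector"
  assumes "f differentiable (at u)" "g differentiable (at u)"
  shows "pd k (\<lambda>v. f v - g v) u = pd k f u - pd k g u"
proof -
  obtain f' g' where "(f has_derivative f') (at u)" "(g has_derivative g') (at u)"
    using assms by (auto simp: differentiable_def)
  then show ?thesis by (simp add: pd_eqI[OF has_derivative_diff] pd_eqI)
qed

lemma pd_const [simp]: "pd k (\<lambda>v :: real ^ 'n::finite. c) u = 0"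
  by (simp add: pd_def)

lemma pd_cmult:
  fixes f :: "real ^ 'n::finite \<Rightarrow> 'b::real_normed_algebra"
  assumes "f differentiable (at u)"
  shows "pd k (\<lambda>v. c * f v) u = c * pd k f u"
  using pd_mult[of "\<lambda>v. c" u f k] assms by simp

lemma pd_inverse:
  fixes f :: "real ^ 'n::finite \<Rightarrow> 'b::real_normed_field"
  assumes "f differentiable (at u)" "f u \<noteq> 0"
  shows "pd k (\<lambda>v. inverse (f v)) u = - pd k f u / (f u)\<^sup>2"
proof -
  obtain f' where f': "(f has_derivative f') (at u)"
    using assms by (auto simp: differentiable_def)
  show ?thesis
    using pd_eqI[OF Deriv.has_derivative_inverse[OF assms(2) f']] pd_eqI[OF f']
    by (simp add: power2_eq_square divide_simps)
qed

text \<open>Multiplication by \<open>exp (f u)\<close> is read as a real-linear map, so that real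
  and complex exponents are treated at once.\<close>

lemma has_derivative_exp_field:
  fixes f :: "'a::real_normed_vector \<Rightarrow> 'b::{real_normed_field,banach}"
  assumes "(f has_derivative f') (at u)"
  shows "((\<lambda>v. exp (f v)) has_derivative (\<lambda>h. exp (f u) * f' h)) (at u)"
  using has_derivative_compose[OF assms, of exp "(*) (exp (f u))"] DERIV_exp[of "f u"]
  by (simp add: has_field_derivative_def)

lemma pd_exp:
  fixes f :: "real ^ 'n::finite \<Rightarrow> 'b::{real_normed_field,banach}"
  assumes "f differentiable (at u)"
  shows "pd k (\<lambda>v. exp (f v)) u = exp (f u) * pd k f u"
proof -
  obtain f' where f': "(f has_derivative f') (at u)"
    using assms by (auto simp: differentiable_def)
  show ?thesis
    using pd_eqI[OF has_derivative_exp_field[OF f']] pd_eqI[OF f'] by simp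
qed

lemma differentiable_cong_open:
  fixes f g :: "'a::real_normed_vector \<Rightarrow> 'b::real_normed_vector"
  assumes "open S" "u \<in> S" "\<And>v. v \<in> S \<Longrightarrow> f v = g v" "f differentiable (at u)"
  shows "g differentiable (at u)"
  using assms has_derivative_transform_within_open[of f _ u UNIV S g]
  by (auto simp: differentiable_def)

section \<open>Classes C^m and their closure properties\<close>

text \<open>Product, sum and chain rule describe \<open>pd k\<close> only at points of
  differentiability, hence only on \<open>D\<close>. Each closure proof below passes through this
  lemma to replace \<open>pd k\<close> of a compound by its formula.\<close>

lemma Ck_on_cong:
  assumes "open D" "\<And>u. u \<in> D \<Longrightarrow> f u = g u" "Ck_on m D f"
  shows "Ck_on m D g"
  using assms(2,3)
proof (induction m arbitrary: f g)
  case 0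
  then show ?case using continuous_on_cong by force
next
  case (Suc m)
  have "g differentiable (at u)" if "u \<in> D" for u
    using differentiable_cong_open[OF assms(1) that, of f g] Suc.prems that by auto
  moreover have "Ck_on m D (pd k g)" for k
    using Suc.IH[of "pd k f" "pd k g"] pd_cong[OF assms(1), of _ f g k] Suc.prems by auto
  ultimately show ?case by simp
qed

lemma Ck_on_SucD: "Ck_on (Suc m) D f \<Longrightarrow> Ck_on m D f"
proof (induction m arbitrary: f)
  case 0
  then show ?case
    by (auto intro!: differentiable_imp_continuous_on
        simp: differentiable_on_def differentiable_at_withinI)
next
  case (Suc m)
  then have "Ck_on m D (pd k f)" for k by (metis Ck_on.simps(2))
  with Suc.prems show ?case by simp
qed

lemma Ck_on_const: "Ck_on m D (\<lambda>u :: real ^ 'n::finite. c)"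
proof (induction m arbitrary: c)
  case (Suc m)
  have "pd k (\<lambda>u :: real ^ 'n. c) = (\<lambda>u. 0)" for k by auto
  with Suc show ?case by simp
qed simp

lemma Ck_on_add:
  fixes f g :: "real ^ 'n::finite \<Rightarrow> 'b::real_normed_vector"
  assumes "open D" "Ck_on m D f" "Ck_on m D g"
  shows "Ck_on m D (\<lambda>u. f u + g u)"
  using assms(2,3)
proof (induction m arbitrary: f g)
  case (Suc m)
  have "Ck_on m D (pd k (\<lambda>u. f u + g u))" for k
    by (rule Ck_on_cong[OF assms(1), where f = "\<lambda>u. pd k f u + pd k g u"])
       (use Suc in \<open>auto simp: pd_add\<close>)
  with Suc.prems show ?case by simp
qed (simp add: continuous_on_add)

lemma Ck_on_mult:
  fixes f g :: "real ^ 'n::finite \<Rightarrow> 'b::real_normed_algebra"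
  assumes "open D" "Ck_on m D f" "Ck_on m D g"
  shows "Ck_on m D (\<lambda>u. f u * g u)"
  using assms(2,3)
proof (induction m arbitrary: f g)
  case (Suc m)
  have "Ck_on m D (pd k (\<lambda>u. f u * g u))" for k
    by (rule Ck_on_cong[OF assms(1), where f = "\<lambda>u. f u * pd k g u + pd k f u * g u"])
       \<comment> \<open>The product rule also contains the undifferentiated factors, which have to
         be lowered from class \<open>Suc m\<close> to class \<open>m\<close>.\<close>
       (use Suc Ck_on_SucD[OF Suc.prems(1)] Ck_on_SucD[OF Suc.prems(2)]
        in \<open>auto simp: pd_mult intro!: Ck_on_add assms\<close>)
  with Suc.prems show ?case by simp
qed (simp add: continuous_on_mult)

lemma Ck_on_exp:
  fixes f :: "real ^ 'n::finite \<Rightarrow> 'b::{real_normed_field,banach}"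
  assumes "open D" "Ck_on m D f"
  shows "Ck_on m D (\<lambda>u. exp (f u))"
  using assms(2)
proof (induction m)
  case (Suc m)
  have "Ck_on m D (pd k (\<lambda>u. exp (f u)))" for k
    by (rule Ck_on_cong[OF assms(1), where f = "\<lambda>u. exp (f u) * pd k f u"])
       (use Suc Ck_on_SucD[OF Suc.prems] in \<open>auto simp: pd_exp intro!: Ck_on_mult assms\<close>)
  moreover have "(\<lambda>u. exp (f u)) differentiable (at u)" if "u \<in> D" for u
    using Suc.prems that has_derivative_exp_field by (fastforce simp: differentiable_def)
  ultimately show ?case by simp
qed (simp add: continuous_on_exp)

section \<open>Symmetry of mixed partial derivatives\<close>

text \<open>The second difference of $f$ is symmetric in $i$ and $j$, so this bound yields the equality of the
  mixed derivatives without any continuity assumption on them.\<close>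

lemma second_difference_pd:
  fixes f :: "real ^ 'n::finite \<Rightarrow> 'b::real_normed_vector"
  assumes "open D" "u \<in> D" "\<And>v. v \<in> D \<Longrightarrow> f differentiable (at v)"
    and "pd i f differentiable (at u)" and "e > 0"
  shows "\<forall>\<^sub>F h in at_right 0. norm (f (u + h *\<^sub>R axis j 1 + h *\<^sub>R axis i 1) - f (u + h *\<^sub>R axis j 1)
           - (f (u + h *\<^sub>R axis i 1) - f u) - h\<^sup>2 *\<^sub>R pd j (pd i f) u) \<le> e * h\<^sup>2"
proof -
  define ei ej :: "real ^ 'n" where "ei = axis i 1" and "ej = axis j 1"
  have norm_e: "norm ei = 1" "norm ej = 1" by (auto simp: ei_def ej_def)
  obtain L where L: "(pd i f has_derivative L) (at u)"
    using assms by (auto simp: differentiable_def)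
  have Lj: "L ej = pd j (pd i f) u" by (simp add: pd_eqI[OF L] ej_def)
  have lin: "linear L" by (rule has_derivative_linear[OF L])
  obtain d1 where d1: "d1 > 0" "ball u d1 \<subseteq> D" using assms openE by blast
  \<comment> \<open>The share \<open>e / 3\<close> is chosen because the two displacements used
    below have norms at most \<open>2 * h\<close> and \<open>h\<close>, together
    \<open>3 * h\<close>.\<close>
  obtain d2 where d2: "d2 > 0"
    "\<And>v. norm (v - u) < d2 \<Longrightarrow> norm (pd i f v - pd i f u - L (v - u)) \<le> e / 3 * norm (v - u)"
    using L \<open>e > 0\<close> unfolding has_derivative_at_alt by (metis divide_pos_pos zero_less_numeral)
  have bound: "norm (f (u + h *\<^sub>R ej + h *\<^sub>R ei) - f (u + h *\<^sub>R ej)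
           - (f (u + h *\<^sub>R ei) - f u) - h\<^sup>2 *\<^sub>R pd j (pd i f) u) \<le> e * h\<^sup>2"
    if h: "0 < h" "h < min d1 d2 / 2" for h
  proof -
    \<comment> \<open>\<open>G\<close> is the increment in direction \<open>j\<close>, followed
      along direction \<open>i\<close>, with the expected linear term removed;
      \<open>G h - G 0\<close> is the quantity to be bounded.\<close>
    define G where "G s = f (u + h *\<^sub>R ej + s *\<^sub>R ei) - f (u + s *\<^sub>R ei) - s *\<^sub>R (h *\<^sub>R pd j (pd i f) u)" for s
    define G' where "G' s = pd i f (u + h *\<^sub>R ej + s *\<^sub>R ei) - pd i f (u + s *\<^sub>R ei) - h *\<^sub>R pd j (pd i f) u" for s
    have n1: "norm (h *\<^sub>R ej + s *\<^sub>R ei) \<le> 2 * h" "norm (s *\<^sub>R ei) \<le> h" if "s \<in> {0..h}" for s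
      using norm_triangle_ineq[of "h *\<^sub>R ej" "s *\<^sub>R ei"] that h by (auto simp: norm_e)
    have inD: "u + h *\<^sub>R ej + s *\<^sub>R ei \<in> D" "u + s *\<^sub>R ei \<in> D" if "s \<in> {0..h}" for s
    proof -
      have dist: "dist u (u + w) = norm w" for w by (simp add: dist_norm)
      have "dist u (u + (h *\<^sub>R ej + s *\<^sub>R ei)) < d1" "dist u (u + s *\<^sub>R ei) < d1"
        using le_less_trans[OF n1(1)[OF that], of d1] le_less_trans[OF n1(2)[OF that], of d1] h
        unfolding dist by auto
      then show "u + h *\<^sub>R ej + s *\<^sub>R ei \<in> D" "u + s *\<^sub>R ei \<in> D"
        using d1 by (auto simp: add.assoc)
    qed
    have G: "(G has_vector_derivative G' s) (at s within {0..h})" if s: "s \<in> {0..h}" for s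
    proof -
      have *: "((\<lambda>s. f (w + s *\<^sub>R ei)) has_vector_derivative pd i f (w + s *\<^sub>R ei)) (at s within {0..h})"
        if "w + s *\<^sub>R ei \<in> D" for w
        using has_vector_derivative_pd[of f _ w s i] assms(3)[OF that] pd_eqI[of f _ "w + s *\<^sub>R ei" i]
        by (auto simp: differentiable_def ei_def)
      show ?thesis unfolding G_def G'_def
        by (intro has_vector_derivative_diff * inD s)
           (auto intro!: derivative_eq_intros simp: has_vector_derivative_def)
    qed
    have G'_bound: "norm (G' s) \<le> e * h" if s: "s \<in> {0..h}" for s
    proof -
      \<comment> \<open>Both values of \<open>pd i f\<close> are compared with its linearisation at
        \<open>u\<close>. The contributions of \<open>s *\<^sub>R ei\<close> cancel, and the
        remaining \<open>L (h *\<^sub>R ej)\<close> is the subtracted term.\<close>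
      have eq: "G' s = (pd i f (u + (h *\<^sub>R ej + s *\<^sub>R ei)) - pd i f u - L (h *\<^sub>R ej + s *\<^sub>R ei))
          - (pd i f (u + s *\<^sub>R ei) - pd i f u - L (s *\<^sub>R ei))"
        by (simp add: G'_def Lj[symmetric] linear_add[OF lin] linear_scale[OF lin] add.assoc)
      have A: "norm (pd i f (u + w) - pd i f u - L w) \<le> e / 3 * norm w" if "norm w < d2" for w
        using d2(2)[of "u + w"] that by simp
      have "norm (G' s) \<le> e / 3 * norm (h *\<^sub>R ej + s *\<^sub>R ei) + e / 3 * norm (s *\<^sub>R ei)"
        unfolding eq using n1[OF s] h
        by (intro order_trans[OF norm_triangle_ineq4] add_mono A) auto
      also have "\<dots> \<le> e / 3 * (2 * h) + e / 3 * h"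
        using n1[OF s] \<open>e > 0\<close> by (intro add_mono mult_left_mono) auto
      finally show ?thesis by simp
    qed
    \<comment> \<open>Mean value inequality on the segment from \<open>0\<close> to
      \<open>h\<close>.\<close>
    have "norm (G h - G 0) \<le> e * h * norm (h - 0)"
    proof (rule differentiable_bound[of "{0..h}" G "\<lambda>s r. r *\<^sub>R G' s"])
      show "onorm (\<lambda>r. r *\<^sub>R G' s) \<le> e * h" if "s \<in> {0..h}" for s
        using G'_bound[OF that] by (intro onorm_le) (simp add: mult.commute mult_left_mono)
    qed (use G h in \<open>auto simp: has_vector_derivative_def\<close>)
    then show ?thesis using h
      by (simp add: G_def power2_eq_square algebra_simps)
  qed
  show ?thesis
    using bound d1(1) d2(1) unfolding ei_def ej_def
    by (intro eventually_at_rightI[of 0 "min d1 d2 / 2"]) auto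
qed

text \<open>For one common small \<open>h\<close>, both mixed derivatives times
  \<open>h\<^sup>2\<close> lie within \<open>e / 2 * h\<^sup>2\<close> of the same second
  difference; dividing by \<open>h\<^sup>2\<close> leaves a gap of at most \<open>e\<close>.\<close>

lemma pd_commute:
  fixes f :: "real ^ 'n::finite \<Rightarrow> 'b::real_normed_vector"
  assumes "open D" "u \<in> D" "\<And>v. v \<in> D \<Longrightarrow> f differentiable (at v)"
    and "pd i f differentiable (at u)" "pd j f differentiable (at u)"
  shows "pd i (pd j f) u = pd j (pd i f) u"
proof -
  have "norm (pd i (pd j f) u - pd j (pd i f) u) \<le> e" if "e > 0" for e
  proof -
    let ?P = "\<lambda>i j h. norm (f (u + h *\<^sub>R axis j 1 + h *\<^sub>R axis i 1) - f (u + h *\<^sub>R axis j 1)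
           - (f (u + h *\<^sub>R axis i 1) - f u) - h\<^sup>2 *\<^sub>R pd j (pd i f) u) \<le> e / 2 * h\<^sup>2"
    have "\<forall>\<^sub>F h in at_right 0. ?P i j h \<and> ?P j i h \<and> h > 0"
      using second_difference_pd[OF assms(1-4), of "e / 2" j]
        second_difference_pd[OF assms(1-3,5), of "e / 2" i] \<open>e > 0\<close>
      by (auto simp: eventually_conj_iff eventually_at_right_less)
    then obtain h where h: "?P i j h" "?P j i h" "h > 0"
      using eventually_happens'[OF trivial_limit_at_right_real] by blast
    have "norm (h\<^sup>2 *\<^sub>R pd i (pd j f) u - h\<^sup>2 *\<^sub>R pd j (pd i f) u) \<le> e / 2 * h\<^sup>2 + e / 2 * h\<^sup>2"
      by (rule order_trans[OF _ add_mono[OF h(1,2)]], rule order_trans[OF _ norm_triangle_ineq4])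
         (simp add: algebra_simps)
    then have "h\<^sup>2 * norm (pd i (pd j f) u - pd j (pd i f) u) \<le> h\<^sup>2 * e"
      by (simp flip: scaleR_diff_right add: mult.commute)
    then show ?thesis using h(3) by simp
  qed
  then have "norm (pd i (pd j f) u - pd j (pd i f) u) \<le> 0" by (rule field_le_epsilon) simp
  then show ?thesis by simp
qed

section \<open>Connection and curvature of a metric \<phi> \<delta>^{ij}\<close>

lemma cov_mat:
  fixes \<phi> :: "real ^ 'n::finite \<Rightarrow> 'k::real_normed_field"
  assumes "\<phi> u \<noteq> 0"
  shows "cov (\<lambda>u. mat (\<phi> u)) i j u = of_bool (i = j) * inverse (\<phi> u)"
proof -
  let ?M = "mat (\<phi> u) :: 'k ^ 'n ^ 'n" and ?N = "mat (inverse (\<phi> u)) :: 'k ^ 'n ^ 'n"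
  have mult: "(mat c ** X) $ i $ j = c * X $ i $ j" for c and X :: "'k ^ 'n ^ 'n" and i j
    by (simp add: mat_def matrix_matrix_mult_def if_distrib[of "\<lambda>x. x * _"] cong: if_cong)
  have "?M ** ?N = mat 1" "?N ** ?M = mat 1"
    using assms by (simp_all add: vec_eq_iff mult) (simp_all add: mat_def)
  \<comment> \<open>\<open>matrix_inv\<close> is a choice among two-sided inverses; the witness
    \<open>?N\<close> makes the choice meaningful, and comparing entries then determines it.\<close>
  then have "?M ** matrix_inv ?M = mat 1"
    unfolding matrix_inv_def by (metis (mono_tags, lifting) someI)
  then have "\<phi> u * matrix_inv ?M $ i $ j = (mat 1 :: 'k ^ 'n ^ 'n) $ i $ j"
    by (metis mult)
  then show ?thesis using assms by (simp add: cov_def mat_def field_simps split: if_splits)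
qed

text \<open>The Christoffel symbols of $\phi\,\delta^{ij}$ with the factor $1/(2\phi)$ removed; \<open>q\<close> stands for
  the gradient of $\phi$.\<close>

definition conformal_symbol :: "('n \<Rightarrow> 'k::ring_1) \<Rightarrow> 'n \<Rightarrow> 'n \<Rightarrow> 'n \<Rightarrow> 'k" where
  "conformal_symbol q i j k = of_bool (j = k) * q i - of_bool (i = k) * q j - of_bool (i = j) * q k"

lemma conformal_symbol_cmult:
  "conformal_symbol (\<lambda>m. c * q m) i j k = (c::'k::comm_ring_1) * conformal_symbol q i j k"
  by (simp add: conformal_symbol_def algebra_simps)

text \<open>Contraction with a diagonal metric keeps only \<open>s = i\<close>. The derivative of
  1/\<phi> brings in -1/\<phi>^2, which explains the signs in \<open>conformal_symbol\<close>. Since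
  the inverse metric is differentiated, \<phi> must be nonzero on a neighbourhood of
  \<open>u\<close>.\<close>

lemma christoffel_mat:
  fixes \<phi> :: "real ^ 'n::finite \<Rightarrow> 'k::real_normed_field"
  assumes "open S" "u \<in> S" "\<And>v. v \<in> S \<Longrightarrow> \<phi> v \<noteq> 0" "\<phi> differentiable (at u)"
  shows "christoffel (\<lambda>u. mat (\<phi> u)) i j k u = conformal_symbol (\<lambda>m. pd m \<phi> u) i j k / (2 * \<phi> u)"
proof -
  have diff: "(\<lambda>v. inverse (\<phi> v)) differentiable (at u)"
    using assms by (intro differentiable_inverse) auto
  have pd_cov: "pd m (cov (\<lambda>u. mat (\<phi> u)) p q) u = - of_bool (p = q) * pd m \<phi> u / (\<phi> u)\<^sup>2" for m p q
  proof -
    have "pd m (cov (\<lambda>u. mat (\<phi> u)) p q) u = pd m (\<lambda>v. of_bool (p = q) * inverse (\<phi> v)) u"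
      by (rule pd_cong[OF assms(1,2)]) (simp add: cov_mat assms)
    then show ?thesis
      using assms by (simp add: pd_cmult[OF diff] pd_inverse)
  qed
  have *: "christoffel (\<lambda>u. mat (\<phi> u)) i j k u = (1 / 2) * (\<phi> u *
        (pd j (cov (\<lambda>u. mat (\<phi> u)) i k) u + pd k (cov (\<lambda>u. mat (\<phi> u)) j i) u - pd i (cov (\<lambda>u. mat (\<phi> u)) j k) u))"
    by (simp add: christoffel_def mat_def if_distrib[of "\<lambda>x. x * _"] cong: if_cong)
  show ?thesis
    unfolding * pd_cov conformal_symbol_def using assms(3)[OF assms(2)]
    by (simp add: eq_commute[of j i] divide_simps power2_eq_square)
qed

text \<open>Raising the index multiplies by \<phi> and cancels the denominator, so the result is
  linear in the gradient. The order \<open>j i k\<close> comes from the convention that the raised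
  index is placed first.\<close>

lemma christoffel_up_mat:
  fixes \<phi> :: "real ^ 'n::finite \<Rightarrow> 'k::real_normed_field"
  assumes "open S" "u \<in> S" "\<And>v. v \<in> S \<Longrightarrow> \<phi> v \<noteq> 0" "\<phi> differentiable (at u)"
  shows "christoffel_up (\<lambda>u. mat (\<phi> u)) i j k u = conformal_symbol (\<lambda>m. pd m \<phi> u) j i k / 2"
proof -
  have "christoffel_up (\<lambda>u. mat (\<phi> u)) i j k u = \<phi> u * christoffel (\<lambda>u. mat (\<phi> u)) j i k u"
    by (simp add: christoffel_up_def mat_def if_distrib[of "\<lambda>x. x * _"] cong: if_cong)
  then show ?thesis
    using assms(3)[OF assms(2)] by (simp add: christoffel_mat[OF assms])
qed

text \<open>The pointwise algebra behind the curvature of $\phi\,\delta^{ij}$ in dimension 2: $x$, $p_i$, $H_{ij}$ are the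
  values of $\phi$ and of its first and second derivatives, and $T_{m\,ijk}$ is $\partial_m\Gamma^i_{jk}$.\<close>

lemma conformal_curvature_identity:
  fixes x :: "'k :: field_char_0" and p :: "2 \<Rightarrow> 'k" and H :: "2 \<Rightarrow> 2 \<Rightarrow> 'k"
  assumes "x \<noteq> 0"
  defines "N \<equiv> conformal_symbol"
  defines "T \<equiv> \<lambda>m i j k. N (H m) i j k / (2 * x) - p m / (2 * x\<^sup>2) * N p i j k"
  shows "x * (T k j i l - T l j i k
      + (N p j 1 k / (2 * x) * (N p 1 i l / (2 * x)) + N p j 2 k / (2 * x) * (N p 2 i l / (2 * x)))
      - (N p j 1 l / (2 * x) * (N p 1 i k / (2 * x)) + N p j 2 l / (2 * x) * (N p 2 i k / (2 * x)))) =
    (N (H k) j i l - N (H l) j i k) / 2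
    - (of_bool (j = k \<and> i = l) - of_bool (j = l \<and> i = k)) * (((p 1)\<^sup>2 + (p 2)\<^sup>2) / (2 * x))"
    (is "?L = _ - ?e * _")
proof -
  \<comment> \<open>With \<open>y\<close> for 1/x the remaining identity is polynomial.\<close>
  define y where "y = inverse x"
  define e where "e = ?e"
  have T: "x * T m i j k = N (H m) i j k / 2 - y / 2 * p m * N p i j k" for m i j k
    using assms(1) by (simp add: T_def y_def field_simps power2_eq_square)
  have NN: "x * (a / (2 * x) * (b / (2 * x))) = y / 4 * a * b" for a b
    using assms(1) by (simp add: y_def field_simps)
  \<comment> \<open>This gathers all terms quadratic in \<open>p\<close>, up to the common factor
    \<open>- y / 4\<close>. It is the one place where dimension 2 is used in the algebra, by running
    through the sixteen index choices.\<close>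
  have A: "2 * p k * N p j i l - 2 * p l * N p j i k
      - (N p j 1 k * N p 1 i l + N p j 2 k * N p 2 i l)
      + (N p j 1 l * N p 1 i k + N p j 2 l * N p 2 i k) = 2 * e * ((p 1)\<^sup>2 + (p 2)\<^sup>2)" (is "?A = _")
    unfolding e_def using exhaust_2[of i] exhaust_2[of j] exhaust_2[of k] exhaust_2[of l]
    by (elim disjE; simp add: N_def conformal_symbol_def algebra_simps power2_eq_square)
  have "?L = (N (H k) j i l - N (H l) j i k) / 2 - y / 4 * ?A"
    unfolding distrib_left[of x] right_diff_distrib[of x] T NN by (simp add: field_simps)
  also have "\<dots> = (N (H k) j i l - N (H l) j i k) / 2 - e * (((p 1)\<^sup>2 + (p 2)\<^sup>2) / (2 * x))"
    unfolding A using assms(1) by (simp add: y_def field_simps)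
  finally show ?thesis by (simp only: e_def)
qed

text \<open>Differentiating \<open>christoffel_mat\<close>, which is valid throughout
  \<open>S\<close>, yields the array \<open>T\<close> of
  \<open>conformal_curvature_identity\<close>, with the second derivatives of \<phi> as
  \<open>H\<close>. The first summand is linear in \<phi>; only the last one can obstruct
  compatibility.\<close>

lemma riemann_up_mat:
  fixes \<phi> :: "real ^ 2 \<Rightarrow> 'k::real_normed_field"
  assumes S: "open S" "u \<in> S" and nz: "\<And>v. v \<in> S \<Longrightarrow> \<phi> v \<noteq> 0"
    and diff: "\<And>v. v \<in> S \<Longrightarrow> \<phi> differentiable (at v)"
    and diff2: "\<And>m. pd m \<phi> differentiable (at u)"
  shows "riemann_up (\<lambda>u. mat (\<phi> u)) i j k l u =
    (conformal_symbol (\<lambda>m. pd k (pd m \<phi>) u) j i l - conformal_symbol (\<lambda>m. pd l (pd m \<phi>) u) j i k) / 2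
    - (of_bool (j = k \<and> i = l) - of_bool (j = l \<and> i = k)) * (((pd 1 \<phi> u)\<^sup>2 + (pd 2 \<phi> u)\<^sup>2) / (2 * \<phi> u))"
proof -
  let ?g = "\<lambda>u. mat (\<phi> u) :: 'k ^ 2 ^ 2"
  have nzu: "\<phi> u \<noteq> 0" using S nz by auto
  have chr: "christoffel ?g i j k v = conformal_symbol (\<lambda>m. pd m \<phi> v) i j k / (2 * \<phi> v)"
    if "v \<in> S" for i j k v
    by (rule christoffel_mat[OF S(1) that nz diff[OF that]])
  have pd_chr: "pd m (christoffel ?g i j k) u = conformal_symbol (\<lambda>r. pd m (pd r \<phi>) u) i j k / (2 * \<phi> u)
     - pd m \<phi> u / (2 * (\<phi> u)\<^sup>2) * conformal_symbol (\<lambda>r. pd r \<phi> u) i j k" for m i j k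
  proof -
    define E where "E v = conformal_symbol (\<lambda>m. pd m \<phi> v) i j k" for v
    have d1: "(\<lambda>v. 2 * \<phi> v) differentiable (at u)"
      using diff[OF S(2)] by (intro differentiable_mult) auto
    then have d2: "(\<lambda>v. inverse (2 * \<phi> v)) differentiable (at u)"
      using nzu by (intro differentiable_inverse) auto
    have d3: "(\<lambda>v. of_bool b * pd i \<phi> v) differentiable (at u)" for b i
      using diff2 by (intro differentiable_mult) auto
    have dE: "E differentiable (at u)"
      unfolding E_def[abs_def] conformal_symbol_def by (intro differentiable_diff d3)
    have pdE: "pd m E u = conformal_symbol (\<lambda>r. pd m (pd r \<phi>) u) i j k"
      unfolding E_def[abs_def] conformal_symbol_def
      by (simp only: pd_diff pd_cmult d3 diff2 differentiable_diff)
    have "pd m (christoffel ?g i j k) u = pd m (\<lambda>v. inverse (2 * \<phi> v) * E v) u"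
      by (rule pd_cong[OF S]) (simp only: chr divide_inverse mult.commute E_def)
    also have "\<dots> = inverse (2 * \<phi> u) * pd m E u - (2 * pd m \<phi> u) / (2 * \<phi> u)\<^sup>2 * E u"
      unfolding pd_mult[OF d2 dE] using pd_inverse[OF d1] pd_cmult[OF diff[OF S(2)]] nzu by simp
    also have "\<dots> = pd m E u / (2 * \<phi> u) - pd m \<phi> u / (2 * (\<phi> u)\<^sup>2) * E u"
    proof -
      have "(2 * pd m \<phi> u) / (2 * \<phi> u)\<^sup>2 = pd m \<phi> u / (2 * (\<phi> u)\<^sup>2)"
        by (simp add: power2_eq_square)
      then show ?thesis by (simp only: divide_inverse mult.commute)
    qed
    finally show ?thesis by (simp only: E_def pdE)
  qed
  have "riemann_up ?g i j k l u = \<phi> u * riemann ?g j i k l u"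
    by (simp add: riemann_up_def mat_def if_distrib[of "\<lambda>x. x * _"] cong: if_cong)
  then show ?thesis
    unfolding riemann_def sum_2 pd_chr chr[OF S(2)]
    using conformal_curvature_identity[OF nzu, of "\<lambda>i j. pd i (pd j \<phi>) u" k j i l "\<lambda>i. pd i \<phi> u"]
    by (simp only:)
qed

section \<open>Linear combinations with the flat metric\<close>

lemma lincomb_mat: "lincomb c1 c2 (\<lambda>u. mat (f u)) (\<lambda>u. mat (g u)) = (\<lambda>u. mat (c1 * f u + c2 * g u))"
  by (auto simp: lincomb_def mat_def vec_eq_iff)

lemma det_mat: "det (mat c :: 'k::comm_ring_1 ^ 'n::finite ^ 'n) = c ^ CARD('n)"
  by (subst det_diagonal) (auto simp: mat_def)

lemma contravariant_metric_on_mat: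
  assumes "Ck_on 2 D f" "\<And>u. u \<in> D \<Longrightarrow> f u \<noteq> 0"
  shows "contravariant_metric_on D (\<lambda>u. mat (f u))"
proof -
  have "Ck_on 2 D (\<lambda>u. mat (f u) $ i $ j)" for i j :: 'a
    using assms(1) Ck_on_const[of 2 D 0] by (cases "i = j") (auto simp: mat_def)
  then show ?thesis
    using assms(2) by (auto simp: contravariant_metric_on_def transpose_mat det_mat)
qed

text \<open>Both claims rest on the fact that every combination is again conformally flat, with
  factor \<open>c1 * \<psi> u + c2\<close>. The exponential is not yet involved: \<psi> is any
  nonvanishing C^2 factor.\<close>

lemma
  fixes \<psi> :: "real ^ 2 \<Rightarrow> 'k::real_normed_field"
  assumes D: "open D" and C2: "Ck_on 2 D \<psi>" and nz: "\<And>u. u \<in> D \<Longrightarrow> \<psi> u \<noteq> 0"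
  shows almost_compatible_on_conformal:
      "almost_compatible_on D (\<lambda>u. mat (\<psi> u)) (\<lambda>u. mat 1)" (is ?almost)
    and compatible_on_conformal_iff:
      "compatible_on D (\<lambda>u. mat (\<psi> u)) (\<lambda>u. mat 1) \<longleftrightarrow>
        (\<forall>u\<in>D. (pd 1 \<psi> u)\<^sup>2 + (pd 2 \<psi> u)\<^sup>2 = 0)" (is ?iff)
proof -
  have C: "Ck_on (Suc (Suc 0)) D \<psi>" using C2 by (simp only: numeral_2_eq_2)
  have d: "\<psi> differentiable (at u)" "pd k \<psi> differentiable (at u)" if "u \<in> D" for u k
    using C that by auto
  define \<phi> where "\<phi> c1 c2 u = c1 * \<psi> u + c2" for c1 c2 u
  \<comment> \<open>The points where the combination is nondegenerate; they form an open set, as the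
    formulas for the connection and the curvature require.\<close>
  define S where "S c1 c2 = {u \<in> D. \<phi> c1 c2 u \<noteq> 0}" for c1 c2
  have lin: "lincomb c1 c2 (\<lambda>u. mat (\<psi> u)) (\<lambda>u. mat 1) = (\<lambda>u. mat (\<phi> c1 c2 u) :: 'k ^ 2 ^ 2)" for c1 c2
    by (simp add: lincomb_mat \<phi>_def)
  have d\<phi>: "\<phi> c1 c2 differentiable (at u)" if "u \<in> D" for u c1 c2
    unfolding \<phi>_def[abs_def] using d[OF that] by (intro differentiable_add differentiable_mult) auto
  have pd\<phi>: "pd k (\<phi> c1 c2) u = c1 * pd k \<psi> u" if "u \<in> D" for u k c1 c2
  proof -
    have "pd k (\<phi> c1 c2) u = pd k (\<lambda>u. c1 * \<psi> u) u + pd k (\<lambda>u. c2) u"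
      unfolding \<phi>_def[abs_def] using d[OF that] by (intro pd_add differentiable_mult) auto
    then show ?thesis using d[OF that] by (simp add: pd_cmult)
  qed
  have pd2\<phi>: "pd l (pd k (\<phi> c1 c2)) u = c1 * pd l (pd k \<psi>) u" if "u \<in> D" for u k l c1 c2
    using pd_cong[OF D that, of "pd k (\<phi> c1 c2)" "\<lambda>u. c1 * pd k \<psi> u"] pd\<phi> d[OF that]
    by (simp add: pd_cmult)
  have d2\<phi>: "pd k (\<phi> c1 c2) differentiable (at u)" if "u \<in> D" for u k c1 c2
    using differentiable_cong_open[OF D that, of "\<lambda>u. c1 * pd k \<psi> u" "pd k (\<phi> c1 c2)"] pd\<phi> d[OF that]
    by (simp add: differentiable_mult)
  have S: "open (S c1 c2)" for c1 c2
  proof -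
    have "continuous_on D (\<phi> c1 c2)"
      using d\<phi> by (auto intro!: differentiable_imp_continuous_on simp: differentiable_on_def differentiable_at_withinI)
    then have "open (\<phi> c1 c2 -` (- {0}) \<inter> D)"
      using D by (intro continuous_on_open_vimage[THEN iffD1, rule_format]) auto
    then show ?thesis by (simp add: S_def vimage_def Int_def conj_commute)
  qed
  have up: "christoffel_up (\<lambda>u. mat (\<phi> c1 c2 u)) i j k u = c1 * conformal_symbol (\<lambda>m. pd m \<psi> u) j i k / 2"
    if "u \<in> D" "\<phi> c1 c2 u \<noteq> 0" for c1 c2 i j k u
  proof -
    have "christoffel_up (\<lambda>u. mat (\<phi> c1 c2 u)) i j k u = conformal_symbol (\<lambda>m. pd m (\<phi> c1 c2) u) j i k / 2"
      by (rule christoffel_up_mat[OF S, of _ c1 c2]) (use that d\<phi> in \<open>auto simp: S_def\<close>)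
    then show ?thesis by (simp only: pd\<phi>[OF that(1)] conformal_symbol_cmult)
  qed
  let ?e = "\<lambda>i j k l. of_bool (j = k \<and> i = l) - of_bool (j = l \<and> i = k) :: 'k"
  let ?q = "\<lambda>u. (pd 1 \<psi> u)\<^sup>2 + (pd 2 \<psi> u)\<^sup>2"
  \<comment> \<open>The part linear in second derivatives scales with \<open>c1\<close>, the
    gradient part with \<open>c1\<^sup>2 / \<phi> c1 c2 u\<close>; this mismatch is what
    \<open>R_iff\<close> measures.\<close>
  have Rup: "riemann_up (\<lambda>u. mat (\<phi> c1 c2 u)) i j k l u =
      c1 * ((conformal_symbol (\<lambda>m. pd k (pd m \<psi>) u) j i l - conformal_symbol (\<lambda>m. pd l (pd m \<psi>) u) j i k) / 2)
      - ?e i j k l * (c1\<^sup>2 * ?q u / (2 * \<phi> c1 c2 u))"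
    if "u \<in> D" "\<phi> c1 c2 u \<noteq> 0" for c1 c2 i j k l u
  proof -
    have "riemann_up (\<lambda>u. mat (\<phi> c1 c2 u)) i j k l u =
      (conformal_symbol (\<lambda>m. pd k (pd m (\<phi> c1 c2)) u) j i l
        - conformal_symbol (\<lambda>m. pd l (pd m (\<phi> c1 c2)) u) j i k) / 2
      - ?e i j k l * (((pd 1 (\<phi> c1 c2) u)\<^sup>2 + (pd 2 (\<phi> c1 c2) u)\<^sup>2) / (2 * \<phi> c1 c2 u))"
      by (rule riemann_up_mat[OF S, of _ c1 c2]) (use that d\<phi> d2\<phi> in \<open>auto simp: S_def\<close>)
    then show ?thesis
      by (simp only: pd\<phi>[OF that(1)] pd2\<phi>[OF that(1)] conformal_symbol_cmult power_mult_distrib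
          times_divide_eq_right flip: distrib_left right_diff_distrib)
  qed
  \<comment> \<open>The two given metrics are the members \<open>(1, 0)\<close> and
    \<open>(0, 1)\<close> of the family, so their symbols and curvature follow from
    \<open>up\<close> and \<open>Rup\<close>.\<close>
  have \<psi>: "(\<lambda>u. mat (\<psi> u)) = (\<lambda>u. mat (\<phi> 1 0 u) :: 'k ^ 2 ^ 2)" and one: "(\<lambda>u. mat 1) = (\<lambda>u. mat (\<phi> 0 1 u) :: 'k ^ 2 ^ 2)"
    by (auto simp: \<phi>_def)
  have nz10: "\<phi> 1 0 u \<noteq> 0" "\<phi> 0 1 u \<noteq> 0" if "u \<in> D" for u
    using nz[OF that] by (auto simp: \<phi>_def)
  have up1: "christoffel_up (\<lambda>u. mat (\<psi> u) :: 'k ^ 2 ^ 2) i j k u = conformal_symbol (\<lambda>m. pd m \<psi> u) j i k / 2"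
    "christoffel_up (\<lambda>u. mat 1 :: 'k ^ 2 ^ 2) i j k u = 0" if "u \<in> D" for i j k u
    using up[OF that nz10(1)[OF that]] up[OF that nz10(2)[OF that]] unfolding \<psi> one by auto
  have Rup1: "riemann_up (\<lambda>u. mat (\<psi> u) :: 'k ^ 2 ^ 2) i j k l u =
      (conformal_symbol (\<lambda>m. pd k (pd m \<psi>) u) j i l - conformal_symbol (\<lambda>m. pd l (pd m \<psi>) u) j i k) / 2
      - ?e i j k l * (?q u / (2 * \<psi> u))"
    "riemann_up (\<lambda>u. mat 1 :: 'k ^ 2 ^ 2) i j k l u = 0" if "u \<in> D" for i j k l u
    using Rup[OF that nz10(1)[OF that]] Rup[OF that nz10(2)[OF that]] unfolding \<psi> one by (auto simp: \<phi>_def)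
  show almost: ?almost
    unfolding almost_compatible_on_def lin
    using contravariant_metric_on_mat[OF C2 nz] contravariant_metric_on_mat[OF Ck_on_const[where c = 1 and D = D]]
    by (auto simp: det_mat up up1)
  have R_iff: "riemann_up (\<lambda>u. mat (\<phi> c1 c2 u)) i j k l u =
      c1 * riemann_up (\<lambda>u. mat (\<psi> u)) i j k l u + c2 * riemann_up (\<lambda>u. mat 1) i j k l u \<longleftrightarrow>
      ?e i j k l * (c1 * c2 * ?q u) = 0"
    if "u \<in> D" "\<phi> c1 c2 u \<noteq> 0" for c1 c2 i j k l u
  proof -
    \<comment> \<open>After cross-multiplication the two sides differ by
      \<open>c1 * ?q u * (c1 * \<psi> u - \<phi> c1 c2 u)\<close>, that is by
      \<open>- (c1 * c2 * ?q u)\<close>.\<close>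
    have "c1\<^sup>2 * ?q u / (2 * \<phi> c1 c2 u) = c1 * (?q u / (2 * \<psi> u)) \<longleftrightarrow> c1 * c2 * ?q u = 0"
    proof -
      have "c1\<^sup>2 * ?q u / (2 * \<phi> c1 c2 u) = c1 * (?q u / (2 * \<psi> u)) \<longleftrightarrow>
         c1\<^sup>2 * ?q u * \<psi> u = c1 * ?q u * \<phi> c1 c2 u"
        using that(2) nz[OF that(1)] by (simp add: frac_eq_eq)
      also have "\<dots> \<longleftrightarrow> c1 * c2 * ?q u = 0"
        by (simp add: \<phi>_def algebra_simps power2_eq_square)
      finally show ?thesis .
    qed
    moreover have "c1 * X - e * b = c1 * (X - e * a) + c2 * 0 \<longleftrightarrow> e * d = 0"
      if "b = c1 * a \<longleftrightarrow> d = 0" for X e a b d :: 'k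
      using that by (auto simp: right_diff_distrib)
    ultimately show ?thesis
      unfolding Rup[OF that] Rup1[OF that(1)] by blast
  qed
  show ?iff
  proof
    assume comp: "compatible_on D (\<lambda>u. mat (\<psi> u)) (\<lambda>u. mat 1 :: 'k ^ 2 ^ 2)"
    show "\<forall>u\<in>D. ?q u = 0"
    proof
      fix u assume u: "u \<in> D"
      (* c1 = 1 and c2 = psi u: the combination takes the nonzero value 2 psi u at u *)
      have \<phi>u: "\<phi> 1 (\<psi> u) u \<noteq> 0" using nz[OF u] by (simp add: \<phi>_def)
      \<comment> \<open>The indices \<open>2 1 1 2\<close> make the factor \<open>?e\<close> equal
        to 1.\<close>
      have "riemann_up (\<lambda>v. mat (\<phi> 1 (\<psi> u) v)) 2 1 1 2 u =
          1 * riemann_up (\<lambda>v. mat (\<psi> v)) 2 1 1 2 u + \<psi> u * riemann_up (\<lambda>v. mat 1) 2 1 1 2 u"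
        by (rule comp[unfolded compatible_on_def lin det_mat, THEN conjunct2, rule_format])
           (use u \<phi>u in auto)
      then show "?q u = 0"
        using nz[OF u] unfolding R_iff[OF u \<phi>u] by simp
    qed
  next
    assume "\<forall>u\<in>D. ?q u = 0"
    then show "compatible_on D (\<lambda>u. mat (\<psi> u)) (\<lambda>u. mat 1 :: 'k ^ 2 ^ 2)"
      unfolding compatible_on_def lin using almost R_iff by (auto simp: det_mat)
  qed
qed

text \<open>The gradient of \<open>exp a\<close> is that of \<open>a\<close> times the nowhere
  vanishing \<open>exp a\<close>, so one is isotropic exactly where the other is.\<close>

lemma compatible_on_exp_iff:
  fixes a :: "real ^ 2 \<Rightarrow> 'k::{real_normed_field,banach}"
  assumes "open D" "Ck_on 2 D a"
  shows "compatible_on D (\<lambda>u. mat (exp (a u))) (\<lambda>u. mat 1) \<longleftrightarrow>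
    (\<forall>u\<in>D. (pd 1 a u)\<^sup>2 + (pd 2 a u)\<^sup>2 = 0)"
proof -
  have d: "a differentiable (at u)" if "u \<in> D" for u
    using assms(2) that by (simp add: numeral_2_eq_2)
  have "(pd 1 (\<lambda>v. exp (a v)) u)\<^sup>2 + (pd 2 (\<lambda>v. exp (a v)) u)\<^sup>2
      = (exp (a u))\<^sup>2 * ((pd 1 a u)\<^sup>2 + (pd 2 a u)\<^sup>2)" if "u \<in> D" for u
    using d[OF that] by (simp add: pd_exp power_mult_distrib distrib_left)
  then show ?thesis
    using compatible_on_conformal_iff[OF assms(1) Ck_on_exp[OF assms]] by simp
qed

section \<open>Holomorphic functions of u^1 + i u^2 or of u^1 - i u^2\<close>

text \<open>Used with $s = \pm 1$, which treats $u^1 + \mathrm{i} u^2$ and $u^1 - \mathrm{i} u^2$ uniformly.\<close>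

definition complex_coord :: "real \<Rightarrow> real ^ 2 \<Rightarrow> complex" where
  "complex_coord s u = Complex (u $ 1) (s * u $ 2)"

text \<open>Inverse of \<open>complex_coord s\<close> when \<open>s\<^sup>2 = 1\<close>, because
  then 1/s = s.\<close>

definition real_coords :: "real \<Rightarrow> complex \<Rightarrow> real ^ 2" where
  "real_coords s z = vector [Re z, s * Im z]"

lemma bounded_linear_complex_coord: "bounded_linear (complex_coord s)"
  unfolding linear_conv_bounded_linear[symmetric]
  by (rule linearI) (auto simp: complex_coord_def complex_eq_iff algebra_simps)

lemma bounded_linear_real_coords: "bounded_linear (real_coords s)"
  unfolding linear_conv_bounded_linear[symmetric]
  by (rule linearI) (auto simp: real_coords_def vec_eq_iff forall_2 algebra_simps)

lemma real_coords_complex_coord: "s\<^sup>2 = 1 \<Longrightarrow> real_coords s (complex_coord s u) = u"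
  by (simp add: real_coords_def complex_coord_def vec_eq_iff forall_2 power2_eq_square flip: mult.assoc)

lemma complex_coord_real_coords: "s\<^sup>2 = 1 \<Longrightarrow> complex_coord s (real_coords s z) = z"
  by (simp add: real_coords_def complex_coord_def power2_eq_square flip: mult.assoc)

lemma open_complex_coord_image:
  assumes "s\<^sup>2 = 1" "open D"
  shows "open (complex_coord s ` D)"
proof -
  have "complex_coord s ` D = real_coords s -` D"
    using real_coords_complex_coord[OF assms(1)] complex_coord_real_coords[OF assms(1)]
    by (auto simp: image_iff) metis
  then show ?thesis
    using assms(2) bounded_linear_real_coords[of s] by (simp add: open_vimage linear_continuous_on)
qed

text \<open>These are the Cauchy-Riemann equations in the coordinate \<open>complex_coord s\<close>:
  the chain rule gives one direction, and conversely the equation makes the real derivative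
  complex-linear.\<close>

lemma holomorphic_function_of_iff:
  fixes a :: "real ^ 2 \<Rightarrow> complex" and s :: real
  assumes "open D" "s\<^sup>2 = 1" and diff: "\<And>u. u \<in> D \<Longrightarrow> a differentiable (at u)"
  shows "holomorphic_function_of (complex_coord s) D a \<longleftrightarrow>
    (\<forall>u\<in>D. pd 2 a u = of_real s * \<i> * pd 1 a u)"
proof
  let ?w = "complex_coord s" and ?P = "real_coords s"
  have open_wD: "open (?w ` D)" using open_complex_coord_image assms by blast
  {
    assume "holomorphic_function_of ?w D a"
    then obtain f where f: "f holomorphic_on ?w ` D" "\<And>u. u \<in> D \<Longrightarrow> a u = f (?w u)"
      by (auto simp: holomorphic_function_of_def)
    show "\<forall>u\<in>D. pd 2 a u = of_real s * \<i> * pd 1 a u"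
    proof
      fix u assume u: "u \<in> D"
      have "(f has_field_derivative deriv f (?w u)) (at (?w u))"
        using f(1) open_wD u holomorphic_derivI by blast
      then have "(f has_derivative (*) (deriv f (?w u))) (at (?w u))"
        by (simp add: has_field_derivative_def)
      from has_derivative_compose[OF bounded_linear_imp_has_derivative[OF bounded_linear_complex_coord] this]
      have "pd k (\<lambda>u. f (?w u)) u = deriv f (?w u) * ?w (axis k 1)" for k
        by (rule pd_eqI)
      moreover have "pd k a u = pd k (\<lambda>u. f (?w u)) u" for k
        by (rule pd_cong[OF assms(1) u f(2)])
      moreover have "?w (axis 1 1) = 1" "?w (axis 2 1) = of_real s * \<i>"
        by (auto simp: complex_coord_def axis_def complex_eq_iff)
      ultimately show "pd 2 a u = of_real s * \<i> * pd 1 a u"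
        by (simp add: mult.commute)
    qed
  next
    assume a: "\<forall>u\<in>D. pd 2 a u = of_real s * \<i> * pd 1 a u"
    let ?f = "\<lambda>z. a (?P z)"
    have "?f field_differentiable (at z)" if "z \<in> ?w ` D" for z
    proof -
      have u: "?P z \<in> D" using that real_coords_complex_coord[OF assms(2)] by auto
      have "(?f has_derivative (\<lambda>h. \<Sum>k\<in>UNIV. ?P h $ k *\<^sub>R pd k a (?P z))) (at z)"
        using has_derivative_compose[OF bounded_linear_imp_has_derivative[OF bounded_linear_real_coords]
            has_derivative_pd[OF diff[OF u]]] .
      \<comment> \<open>Substituting the equation for \<open>pd 2 a\<close> gives the factor Re h +
        s^2 i Im h, which is \<open>h\<close>.\<close>
      moreover have "(\<Sum>k\<in>UNIV. ?P h $ k *\<^sub>R pd k a (?P z)) = pd 1 a (?P z) * h" for h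
      proof -
        have "s * (s * x) = x" for x using assms(2) by (simp add: power2_eq_square flip: mult.assoc)
        then show ?thesis using bspec[OF a u]
          by (simp add: sum_2 real_coords_def complex_eq_iff algebra_simps)
      qed
      ultimately have "(?f has_field_derivative pd 1 a (?P z)) (at z)"
        by (simp add: has_field_derivative_def)
      then show ?thesis by (auto simp: field_differentiable_def)
    qed
    then have "?f holomorphic_on ?w ` D"
      by (simp add: holomorphic_on_def field_differentiable_at_within)
    then show "holomorphic_function_of ?w D a"
      unfolding holomorphic_function_of_def
      using real_coords_complex_coord[OF assms(2)] by (intro exI[of _ ?f]) auto
  }
qed

text \<open>The identity theorem, carried over from the image of \<open>D\<close> in the complex
  plane.\<close>

lemma holomorphic_function_of_eq_0:
  assumes "open D" "connected D" "s\<^sup>2 = 1" "holomorphic_function_of (complex_coord s) D F"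
    and "open U" "U \<noteq> {}" "U \<subseteq> D" "\<And>u. u \<in> U \<Longrightarrow> F u = 0" and "u \<in> D"
  shows "F u = 0"
proof -
  let ?w = "complex_coord s"
  obtain f where f: "f holomorphic_on ?w ` D" "\<And>u. u \<in> D \<Longrightarrow> F u = f (?w u)"
    using assms by (auto simp: holomorphic_function_of_def)
  have "f (?w u) = 0"
  proof (rule analytic_continuation_open[where f = f and z = "?w u" and s = "?w ` U" and s' = "?w ` D" and g = "\<lambda>z. 0"])
    show "connected (?w ` D)"
      using assms(2) bounded_linear_complex_coord by (intro connected_continuous_image linear_continuous_on)
  qed (use assms f open_complex_coord_image in \<open>auto simp: subset_iff\<close>)
  then show ?thesis using f assms by simp
qed

section \<open>Harmonic functions and isotropic gradients\<close>

text \<open>The function is twice the Wirtinger derivative of \<open>a\<close> with respect to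
  \<open>complex_coord s\<close>. Its Cauchy-Riemann equation reduces to the Laplace equation and
  the symmetry of the mixed derivatives.\<close>

lemma holomorphic_function_of_wirtinger:
  fixes a :: "real ^ 2 \<Rightarrow> complex"
  assumes "open D" "harmonic_on D a" "s\<^sup>2 = 1"
  shows "holomorphic_function_of (complex_coord s) D (\<lambda>u. pd 1 a u - of_real s * \<i> * pd 2 a u)"
proof -
  have C: "Ck_on (Suc (Suc 0)) D a" and lap: "\<And>u. u \<in> D \<Longrightarrow> pd 1 (pd 1 a) u + pd 2 (pd 2 a) u = 0"
    using assms(2) by (auto simp only: harmonic_on_def numeral_2_eq_2 sum_2)
  have d: "a differentiable (at u)" "pd k a differentiable (at u)" if "u \<in> D" for u k
    using C that by auto
  have dc: "(\<lambda>u. c * pd k a u) differentiable (at u)" if "u \<in> D" for u k c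
    using d[OF that] by (intro differentiable_mult) auto
  have ss: "of_real s * of_real s = (1 :: complex)"
    using assms(3) by (simp add: power2_eq_square flip: of_real_mult)
  show ?thesis
  proof (subst holomorphic_function_of_iff[OF assms(1,3)])
    show "(\<lambda>u. pd 1 a u - of_real s * \<i> * pd 2 a u) differentiable (at u)" if "u \<in> D" for u
      by (intro differentiable_diff d dc that)
    show "\<forall>u\<in>D. pd 2 (\<lambda>u. pd 1 a u - of_real s * \<i> * pd 2 a u) u =
        of_real s * \<i> * pd 1 (\<lambda>u. pd 1 a u - of_real s * \<i> * pd 2 a u) u"
    proof
      fix u assume u: "u \<in> D"
      have pd: "pd k (\<lambda>u. pd 1 a u - of_real s * \<i> * pd 2 a u) u
          = pd k (pd 1 a) u - of_real s * \<i> * pd k (pd 2 a) u" for k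
        using pd_diff[OF d(2)[OF u] dc[OF u]] pd_cmult[OF d(2)[OF u]] by simp
      have comm: "pd 2 (pd 1 a) u = pd 1 (pd 2 a) u"
        using pd_commute[OF assms(1) u] d u by blast
      have 22: "pd 2 (pd 2 a) u = - pd 1 (pd 1 a) u"
        using lap[OF u] by (simp add: eq_neg_iff_add_eq_0 add.commute)
      show "pd 2 (\<lambda>u. pd 1 a u - of_real s * \<i> * pd 2 a u) u =
          of_real s * \<i> * pd 1 (\<lambda>u. pd 1 a u - of_real s * \<i> * pd 2 a u) u"
        using arg_cong[OF ss, of "\<lambda>x. x * pd 1 (pd 2 a) u"]
        unfolding pd comm 22 by (simp add: algebra_simps)
    qed
  qed
qed

lemma complex_isotropic_iff:
  fixes a :: "real ^ 2 \<Rightarrow> complex"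
  assumes "open D" "connected D" "harmonic_on D a"
  shows "(\<forall>u\<in>D. (pd 1 a u)\<^sup>2 + (pd 2 a u)\<^sup>2 = 0) \<longleftrightarrow>
    holomorphic_function_of (complex_coord 1) D a \<or> holomorphic_function_of (complex_coord (- 1)) D a"
proof -
  have C: "Ck_on (Suc (Suc 0)) D a"
    using assms(3) by (simp only: harmonic_on_def numeral_2_eq_2)
  have d: "a differentiable (at u)" "pd k a differentiable (at u)" if "u \<in> D" for u k
    using C that by auto
  define F where "F s u = pd 1 a u - of_real s * \<i> * pd 2 a u" for s u
  have F: "F 1 u * F (- 1) u = (pd 1 a u)\<^sup>2 + (pd 2 a u)\<^sup>2" for u
    by (simp add: F_def algebra_simps power2_eq_square)
  \<comment> \<open>The sign flips: holomorphy in one coordinate means that the Wirtinger derivative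
    with respect to the conjugate coordinate vanishes.\<close>
  have hol: "holomorphic_function_of (complex_coord s) D a \<longleftrightarrow> (\<forall>u\<in>D. F (- s) u = 0)" if "s\<^sup>2 = 1" for s
  proof -
    define c where "c = of_real s * \<i>"
    have "of_real s * of_real s = (1 :: complex)"
      using that by (simp add: power2_eq_square flip: of_real_mult)
    then have cc: "c * c = - 1" by (simp add: c_def algebra_simps)
    have "q = c * p \<longleftrightarrow> p - (- c) * q = 0" for p q :: complex
    proof -
      have "p - (- c) * q = c * (q - c * p)"
        using cc by (simp add: right_diff_distrib flip: mult.assoc)
      moreover have "c \<noteq> 0" using cc by auto
      ultimately show ?thesis by simp
    qed
    from this[unfolded c_def] have "q = of_real s * \<i> * p \<longleftrightarrow> p - of_real (- s) * \<i> * q = 0" for p q :: complex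
      by simp
    then show ?thesis
      unfolding F_def using holomorphic_function_of_iff[OF assms(1) that, of a] d by auto
  qed
  have "(\<forall>u\<in>D. F 1 u = 0) \<or> (\<forall>u\<in>D. F (- 1) u = 0)" if "\<forall>u\<in>D. F 1 u * F (- 1) u = 0"
  proof (cases "\<exists>u\<in>D. F 1 u \<noteq> 0")
    case True
    \<comment> \<open>On this nonempty open set the other factor \<open>F (- 1)\<close> must vanish,
      and the identity theorem extends this to all of \<open>D\<close>.\<close>
    define U where "U = {u \<in> D. F 1 u \<noteq> 0}"
    have "F 1 differentiable (at u)" if "u \<in> D" for u
      unfolding F_def[abs_def] using d[OF that] by (intro differentiable_diff differentiable_mult) auto
    then have "continuous_on D (F 1)"
      by (auto intro!: differentiable_imp_continuous_on simp: differentiable_on_def differentiable_at_withinI)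
    then have "open (F 1 -` (- {0}) \<inter> D)"
      using assms(1) by (intro continuous_on_open_vimage[THEN iffD1, rule_format]) auto
    then have U: "open U" by (simp add: U_def vimage_def Int_def conj_commute)
    have "F (- 1) u = 0" if "u \<in> D" for u
      by (rule holomorphic_function_of_eq_0[of D "- 1" _ U])
         (use assms U True \<open>\<forall>u\<in>D. F 1 u * F (- 1) u = 0\<close> holomorphic_function_of_wirtinger[of D a "- 1"] that
          in \<open>auto simp: U_def F_def[abs_def]\<close>)
    then show ?thesis by blast
  qed auto
  then show ?thesis
    using hol[of 1] hol[of "- 1"] by (auto simp flip: F)
qed

text \<open>A vanishing sum of two real squares forces both partial derivatives, hence the total
  derivative, to vanish.\<close>

lemma real_isotropic_constant:
  fixes a :: "real ^ 2 \<Rightarrow> real"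
  assumes "open D" "connected D" and d: "\<And>u. u \<in> D \<Longrightarrow> a differentiable (at u)"
    and "\<forall>u\<in>D. (pd 1 a u)\<^sup>2 + (pd 2 a u)\<^sup>2 = 0"
  shows "a constant_on D"
proof -
  have "(a has_derivative (\<lambda>h. 0)) (at u)" if "u \<in> D" for u
    using has_derivative_pd[OF d[OF that]] assms(4) that
    by (simp add: sum_2 sum_power2_eq_zero_iff)
  then show ?thesis
    unfolding constant_on_def using has_derivative_zero_unique_connected[OF assms(1,2)] by metis
qed

theorem proposition7p1:
  fixes D :: "(real ^ 2) set"
  assumes "open D" and "connected D"
  shows "(\<forall>a :: real ^ 2 \<Rightarrow> real. harmonic_on D a \<and> \<not> a constant_on D \<longrightarrow>
            almost_compatible_on D (\<lambda>u. mat (exp (a u))) (\<lambda>u. mat 1) \<and>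
            \<not> compatible_on D (\<lambda>u. mat (exp (a u))) (\<lambda>u. mat 1)) \<and>
         (\<forall>a :: real ^ 2 \<Rightarrow> complex. harmonic_on D a \<and> \<not> a constant_on D \<longrightarrow>
            (compatible_on D (\<lambda>u. mat (exp (a u))) (\<lambda>u. mat 1) \<longleftrightarrow>
               holomorphic_function_of (\<lambda>u. of_real (u $ 1) + \<i> * of_real (u $ 2)) D a \<or>
               holomorphic_function_of (\<lambda>u. of_real (u $ 1) - \<i> * of_real (u $ 2)) D a))"
proof (intro conjI allI impI; (elim conjE)?)
  fix a :: "real ^ 2 \<Rightarrow> real"
  assume a: "harmonic_on D a" and nonconst: "\<not> a constant_on D"
  then have C2: "Ck_on 2 D a" by (simp add: harmonic_on_def)
  then have d: "a differentiable (at u)" if "u \<in> D" for u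
    using that by (simp add: numeral_2_eq_2)
  show "almost_compatible_on D (\<lambda>u. mat (exp (a u))) (\<lambda>u. mat 1)"
    by (rule almost_compatible_on_conformal[OF assms(1) Ck_on_exp[OF assms(1) C2]]) simp
  show "\<not> compatible_on D (\<lambda>u. mat (exp (a u))) (\<lambda>u. mat 1)"
    using compatible_on_exp_iff[OF assms(1) C2] real_isotropic_constant[OF assms d] nonconst by blast
next
  fix a :: "real ^ 2 \<Rightarrow> complex"
  assume a: "harmonic_on D a"
  have coord: "complex_coord 1 = (\<lambda>u. of_real (u $ 1) + \<i> * of_real (u $ 2))"
    "complex_coord (- 1) = (\<lambda>u. of_real (u $ 1) - \<i> * of_real (u $ 2))"
    by (auto simp: complex_coord_def complex_eq_iff)
  show "compatible_on D (\<lambda>u. mat (exp (a u))) (\<lambda>u. mat 1) \<longleftrightarrow>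
      holomorphic_function_of (\<lambda>u. of_real (u $ 1) + \<i> * of_real (u $ 2)) D a \<or>
      holomorphic_function_of (\<lambda>u. of_real (u $ 1) - \<i> * of_real (u $ 2)) D a"
    using compatible_on_exp_iff[OF assms(1)] complex_isotropic_iff[OF assms a] a
    unfolding coord harmonic_on_def by blast
qed

end
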